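(* Let $\mathcal{G}$ be the three-dimensional cubic grid with edge length $\ell>0$. There exists a constant $C>0$, depending only on $\ell$, such that for every $\psi\in W^{1,1}(\mathcal{G})$ $$\|\psi\|_{L^{3/2}(\mathcal{G})}\leq C\,\|\psi'\|_{L^1(\mathcal{G})}.$$
   Context: Fix $\ell>0$. The three-dimensional grid $\mathcal{G}$ is the metric graph embedded in $\mathbb{R}^3$ with vertex set $\{(i\ell,j\ell,k\ell): (i,j,k)\in\mathbb{Z}^3\}$ and whose edges are the segments of length $\ell$ joining nearest-neighbour vertices (parallel to the coordinate axes). Equivalently $\mathcal{G}$ is the union of the lines $X_{j,k}=\mathbb{R}\times\{j\ell\}\times\{k\ell\}$, $Y_{i,k}=\{i\ell\}\times\mathbb{R}\times\{k\ell\}$, $Z_{i,j}=\{i\ell\}\times\{j\ell\}\times\mathbb{R}$, for $i,j,k\in\mathbb{Z}$. Functions on $\mathcal{G}$ are complex-valued, and $\psi'$ denotes the derivative along each line with respect to arc length. The norms are $$\|\psi\|_{L^p(\mathcal{G})}^p=\sum_{(j,k)\in\mathbb{Z}^2}\int_{X_{j,k}}|\psi|^p\,dx+\sum_{(i,k)\in\mathbb{Z}^2}\int_{Y_{i,k}}|\psi|^p\,dx+\sum_{(i,j)\in\mathbb{Z}^2}\int_{Z_{i,j}}|\psi|^p\,dx.$$ The space $W^{1,1}(\mathcal{G})$ consists of the functions whose restriction to every line $X_{j,k},Y_{i,k},Z_{i,j}$ belongs to $W^{1,1}(\mathbb{R})$, which are continuous at every vertex of $\mathcal{G}$, and for which $\|\psi\|_{L^1(\mathcal{G})}+\|\psi'\|_{L^1(\mathcal{G})}<\infty$.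 *)

theory Defs
  imports "HOL-Analysis.Analysis"
begin

subsection \<open>The Sobolev space \<open>W\<^sup>1\<^sup>,\<^sup>1\<close> of the real line\<close>

definition test_functions :: "(real \<Rightarrow> real) set" where
  "test_functions = {\<phi>. (\<forall>n x. ((deriv ^^ n) \<phi>) differentiable (at x)) \<and>
                        compact (closure {x. \<phi> x \<noteq> 0})}"

definition locally_integrable :: "(real \<Rightarrow> complex) \<Rightarrow> bool" where
  "locally_integrable f \<longleftrightarrow> (\<forall>K. compact K \<longrightarrow> f absolutely_integrable_on K)"

text \<open>Local integrability of both functions is required explicitly: otherwise the Bochner
  integrals below could be zero merely because the integrand is not integrable.\<close>

definition has_weak_deriv :: "(real \<Rightarrow> complex) \<Rightarrow> (real \<Rightarrow> complex) \<Rightarrow> bool" where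
  "has_weak_deriv f g \<longleftrightarrow> locally_integrable f \<and> locally_integrable g \<and>
     (\<forall>\<phi>\<in>test_functions.
        (LINT x|lebesgue. deriv \<phi> x *\<^sub>R f x) = - (LINT x|lebesgue. \<phi> x *\<^sub>R g x))"

text \<open>Weak derivatives are unique up to a null set; this picks a representative.\<close>

definition weak_deriv :: "(real \<Rightarrow> complex) \<Rightarrow> real \<Rightarrow> complex" where
  "weak_deriv f = (SOME g. has_weak_deriv f g)"

definition W11_real :: "(real \<Rightarrow> complex) set" where
  "W11_real = {f. integrable lebesgue f \<and> (\<exists>g. integrable lebesgue g \<and> has_weak_deriv f g)}"

subsection \<open>The cubic grid\<close>

datatype grid_line = X int int | Y int int | Z int int

text \<open>Arc-length parametrisation of the lines \<open>X\<^sub>j\<^sub>,\<^sub>k\<close>, \<open>Y\<^sub>i\<^sub>,\<^sub>k\<close>, \<open>Z\<^sub>i\<^sub>,\<^sub>j\<close>.\<close>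

fun line_point :: "real \<Rightarrow> grid_line \<Rightarrow> real \<Rightarrow> real ^ 3" where
  "line_point l (X j k) t = vector [t, of_int j * l, of_int k * l]"
| "line_point l (Y i k) t = vector [of_int i * l, t, of_int k * l]"
| "line_point l (Z i j) t = vector [of_int i * l, of_int j * l, t]"

definition grid :: "real \<Rightarrow> (real ^ 3) set" where
  "grid l = (\<Union>L. range (line_point l L))"

definition grid_vertices :: "real \<Rightarrow> (real ^ 3) set" where
  "grid_vertices l = {vector [of_int i * l, of_int j * l, of_int k * l] | i j k :: int. True}"

subsection \<open>Function spaces on the grid\<close>

text \<open>A function on the grid is given by a function on the ambient space, whose values off the
  grid are irrelevant. Its restrictions to the lines form a family \<open>grid_line \<Rightarrow> real \<Rightarrow> complex\<close>.
  The derivative along the lines only exists as such a family: at a vertex it may take different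
  values along the three lines meeting there.\<close>

definition on_lines :: "real \<Rightarrow> (real ^ 3 \<Rightarrow> complex) \<Rightarrow> grid_line \<Rightarrow> real \<Rightarrow> complex" where
  "on_lines l \<psi> L t = \<psi> (line_point l L t)"

definition grid_deriv :: "real \<Rightarrow> (real ^ 3 \<Rightarrow> complex) \<Rightarrow> grid_line \<Rightarrow> real \<Rightarrow> complex" where
  "grid_deriv l \<psi> L = weak_deriv (on_lines l \<psi> L)"

text \<open>The integral with respect to the counting measure is the sum over \<open>\<int>\<^sup>2\<close>, with value
  \<open>\<infinity>\<close> if the sum diverges.\<close>

definition grid_integral :: "(grid_line \<Rightarrow> real \<Rightarrow> ennreal) \<Rightarrow> ennreal" where
  "grid_integral u =
     (\<integral>\<^sup>+ (j, k). (\<integral>\<^sup>+ x. u (X j k) x \<partial>lebesgue) \<partial>count_space UNIV) +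
     (\<integral>\<^sup>+ (i, k). (\<integral>\<^sup>+ x. u (Y i k) x \<partial>lebesgue) \<partial>count_space UNIV) +
     (\<integral>\<^sup>+ (i, j). (\<integral>\<^sup>+ x. u (Z i j) x \<partial>lebesgue) \<partial>count_space UNIV)"

definition ennreal_powr :: "ennreal \<Rightarrow> real \<Rightarrow> ennreal" where
  "ennreal_powr a r = (if a = \<infinity> then \<infinity> else ennreal (enn2real a powr r))"

text \<open>The extended \<open>L\<^sup>p\<close> norm, for \<open>0 < p < \<infinity>\<close>.\<close>

definition grid_Lp_norm :: "real \<Rightarrow> (grid_line \<Rightarrow> real \<Rightarrow> complex) \<Rightarrow> ennreal" where
  "grid_Lp_norm p F =
     ennreal_powr (grid_integral (\<lambda>L x. ennreal (norm (F L x) powr p))) (1 / p)"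

text \<open>Representatives may be changed on null sets away from the vertices. Continuity at the
  vertices (for the topology of the grid) forces the continuous representatives on the three
  lines through a vertex to agree there.\<close>

definition W11_grid :: "real \<Rightarrow> (real ^ 3 \<Rightarrow> complex) set" where
  "W11_grid l = {\<psi>.
     (\<forall>L. on_lines l \<psi> L \<in> W11_real) \<and>
     (\<forall>v\<in>grid_vertices l. continuous (at v within grid l) \<psi>) \<and>
     grid_Lp_norm 1 (on_lines l \<psi>) + grid_Lp_norm 1 (grid_deriv l \<psi>) < \<infinity>}"

end

theory Submission
  imports Defs "HOL-Computational_Algebra.Polynomial"
begin

text \<open>
At a vertex three lines meet, and on each of them the modulus of a \<open>W\<^sup>1\<^sup>,\<^sup>1\<close> function is at
most the integral of the modulus of its derivative over that line. So \<open>\<bar>\<psi>\<bar>\<^sup>3\<close> at the vertex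
\<open>(i, j, k)\<close> is at most a product \<open>a j k * b i k * c i j\<close>, in which every factor misses one index.
The Loomis--Whitney inequality for sums (lemma \<open>Loomis_Whitney_sum\<close>) bounds the sum of the square
roots of such products by the square root of the product of the three total sums. Here each total
is at most \<open>T = \<parallel>\<psi>'\<parallel>\<^sub>1\<close>, so the sum of \<open>\<bar>\<psi>\<bar>\<close> to the power \<open>3/2\<close> is at most \<open>T\<close> to the power
\<open>3/2\<close>.

From the vertices to the edges: along an edge, \<open>\<psi>\<close> differs from its value at the initial vertex by
at most the integral of \<open>\<bar>\<psi>'\<bar>\<close> over this edge. Summed over a family of parallel edges, this error
depends on two indices only and can be absorbed into \<open>b\<close> and \<open>c\<close>. Thus the Loomis--Whitney
inequality applies to the integrals over the edges directly (lemma \<open>grid_direction_estimate\<close>), once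
for each of the three directions.

The facts about a single line have to be derived from the definition of weak derivatives by test
functions. Integrability replaces boundary conditions: the functions take arbitrarily small values.
Thus it suffices to bound the increments, \<open>norm (f a - f c)\<close>, by the integral of the derivative
over intervals that contain both points (lemma \<open>weak_deriv_increment_bound\<close>). The test functions used for this have
as derivative the difference of two bumps, located at \<open>a\<close> and at \<open>c\<close>; in the limit of concentrated
bumps the values at Lebesgue points appear. No continuous representative of \<open>f\<close> is constructed;
the values at the vertices come from the continuity of \<open>\<psi>\<close> there.
\<close>

section \<open>Smooth functions of compact support\<close>

text \<open>The classical flat function, with a polynomial \<open>w\<close> in place of the identity. The parameters
\<open>m\<close> and \<open>p\<close> are there so that the family, for fixed \<open>k\<close> and \<open>w\<close>, is closed under
differentiation; this gives derivatives of all orders at once.\<close>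

definition flat_exp :: "real \<Rightarrow> real poly \<Rightarrow> nat \<Rightarrow> real poly \<Rightarrow> real \<Rightarrow> real" where
  "flat_exp k w m p x =
     (if poly w x > 0 then poly p x / poly w x ^ m * exp (- k / poly w x) else 0)"

lemma power_times_exp_le:
  fixes k u :: real
  assumes "k > 0" "u \<ge> 0"
  shows "u ^ n * exp (- k * u) \<le> fact n / k ^ n"
proof -
  have "(k * u) ^ n / fact n \<le> exp (k * u)"
  proof -
    \<comment> \<open>One term of the exponential series is at most its sum.\<close>
    have "(\<Sum>i\<in>{n}. inverse (fact i) * (k * u) ^ i) \<le> (\<Sum>i. inverse (fact i) * (k * u) ^ i)"
      by (rule sum_le_suminf) (use assms summable_exp in auto)
    thus ?thesis by (simp add: exp_def field_simps)
  qed
  hence "u ^ n \<le> fact n / k ^ n * exp (k * u)"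
    using assms by (simp add: field_simps power_mult_distrib)
  thus ?thesis by (simp add: exp_minus field_simps)
qed

text \<open>The exponential absorbs any power of \<open>1 / w\<close>, two more than are present in particular. The
resulting polynomial majorant has a double zero wherever \<open>w\<close> vanishes, which forces the
derivative to be zero there.\<close>

lemma flat_exp_le:
  assumes "k > 0"
  shows "\<bar>flat_exp k w m p x\<bar> \<le> \<bar>poly (smult (fact (m + 2) / k ^ (m + 2)) (p * w ^ 2)) x\<bar>"
proof (cases "poly w x > 0")
  case True
  define W where "W = poly w x"
  have W: "W > 0" using True by (simp add: W_def)
  have "(1 / W) ^ (m + 2) * exp (- k * (1 / W)) \<le> fact (m + 2) / k ^ (m + 2)"
    by (rule power_times_exp_le) (use assms W in auto)
  hence "exp (- k / W) / W ^ m \<le> fact (m + 2) / k ^ (m + 2) * W ^ 2"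
    using W by (simp add: field_simps power_add power2_eq_square)
  hence "\<bar>poly p x\<bar> * (exp (- k / W) / W ^ m) \<le> \<bar>poly p x\<bar> * (fact (m + 2) / k ^ (m + 2) * W ^ 2)"
    by (rule mult_left_mono) simp
  moreover have "\<bar>flat_exp k w m p x\<bar> = \<bar>poly p x\<bar> * (exp (- k / W) / W ^ m)"
    using True W by (simp add: flat_exp_def W_def abs_mult)
  moreover have "\<bar>poly (smult (fact (m + 2) / k ^ (m + 2)) (p * w ^ 2)) x\<bar>
      = \<bar>poly p x\<bar> * (fact (m + 2) / k ^ (m + 2) * W ^ 2)"
    using assms by (simp add: W_def abs_mult)
  ultimately show ?thesis by simp
next
  case False thus ?thesis by (simp add: flat_exp_def)
qed

lemma has_real_derivative_flat_exp:
  assumes "k > 0"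
  shows "(flat_exp k w m p has_real_derivative
           flat_exp k w (m + 2) (pderiv p * w ^ 2 - of_nat m * p * w * pderiv w + smult k (p * pderiv w)) x) (at x)"
proof -
  \<comment> \<open>Off the zero set of \<open>w\<close> the function is locally elementary or zero. At a zero it is
    squeezed by the majorant \<open>h\<close>, which vanishes there together with its derivative.\<close>
  consider (pos) "poly w x > 0" | (neg) "poly w x < 0" | (zero) "poly w x = 0" by linarith
  thus ?thesis
  proof cases
    case pos
    have op: "open {y. poly w y > 0}" by (intro open_Collect_less continuous_intros)
    have d: "((\<lambda>y. poly p y / poly w y ^ m * exp (- k / poly w y)) has_real_derivative
        flat_exp k w (m + 2) (pderiv p * w ^ 2 - of_nat m * p * w * pderiv w + smult k (p * pderiv w)) x) (at x)"
    proof (cases m)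
      case 0
      show ?thesis using pos unfolding 0
        by (auto intro!: derivative_eq_intros simp: flat_exp_def field_simps power2_eq_square)
    next
      case (Suc m')
      show ?thesis using pos unfolding Suc
        by (auto intro!: derivative_eq_intros simp: flat_exp_def field_simps power2_eq_square)
           (metis One_nat_def less_not_refl power_eq_if)
    qed
    show ?thesis
      by (rule DERIV_cong_ev[THEN iffD2, OF refl _ refl d])
         (use pos eventually_nhds_in_open[OF op, of x] in \<open>auto simp: flat_exp_def elim!: eventually_mono\<close>)
  next
    case neg
    have op: "open {y. poly w y < 0}" by (intro open_Collect_less continuous_intros)
    have d: "((\<lambda>y. 0) has_real_derivative
        flat_exp k w (m + 2) (pderiv p * w ^ 2 - of_nat m * p * w * pderiv w + smult k (p * pderiv w)) x) (at x)"
      using neg by (simp add: flat_exp_def)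
    show ?thesis
      by (rule DERIV_cong_ev[THEN iffD2, OF refl _ refl d])
         (use neg eventually_nhds_in_open[OF op, of x] in \<open>auto simp: flat_exp_def elim!: eventually_mono\<close>)
  next
    case zero
    define h where "h = smult (fact (m + 2) / k ^ (m + 2)) (p * w ^ 2)"
    have h0: "poly h x = 0" using zero by (simp add: h_def)
    have "poly (pderiv h) x = 0"
      using zero by (simp add: h_def pderiv_smult pderiv_mult pderiv_power power2_eq_square)
    hence "(poly h has_real_derivative 0) (at x)" using poly_DERIV[of h x] by simp
    hence "((\<lambda>y. poly h y / (y - x)) \<longlongrightarrow> 0) (at x)"
      by (simp add: has_field_derivative_iff h0)
    hence lim: "((\<lambda>y. \<bar>poly h y / (y - x)\<bar>) \<longlongrightarrow> 0) (at x)" by (rule tendsto_rabs_zero)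
    have "\<bar>flat_exp k w m p y\<bar> \<le> \<bar>poly h y\<bar>" for y
      unfolding h_def by (rule flat_exp_le[OF assms])
    hence "((\<lambda>y. flat_exp k w m p y / (y - x)) \<longlongrightarrow> 0) (at x)"
      by (intro Lim_null_comparison[OF _ lim] always_eventually)
         (auto simp: abs_divide intro!: divide_right_mono)
    thus ?thesis using zero by (simp add: has_field_derivative_iff flat_exp_def)
  qed
qed

lemma higher_deriv_flat_exp:
  assumes "k > 0"
  shows "\<exists>m' p'. (deriv ^^ n) (flat_exp k w m p) = flat_exp k w m' p'"
proof (induction n)
  case 0 show ?case by auto
next
  case (Suc n)
  then obtain m' p' where e: "(deriv ^^ n) (flat_exp k w m p) = flat_exp k w m' p'" by blast
  have "deriv (flat_exp k w m' p') =
     flat_exp k w (m' + 2) (pderiv p' * w ^ 2 - of_nat m' * p' * w * pderiv w + smult k (p' * pderiv w))"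
    by (intro ext DERIV_imp_deriv has_real_derivative_flat_exp assms)
  thus ?case using e by auto
qed

definition smooth_real :: "(real \<Rightarrow> real) \<Rightarrow> bool" where
  "smooth_real \<phi> \<longleftrightarrow> (\<forall>n x. ((deriv ^^ n) \<phi>) differentiable (at x))"

lemma smooth_flat_exp: "k > 0 \<Longrightarrow> smooth_real (flat_exp k w m p)"
  unfolding smooth_real_def
  by (metis higher_deriv_flat_exp has_real_derivative_flat_exp real_differentiable_def)

lemma smooth_real_diff:
  assumes "smooth_real f" "smooth_real g"
  shows "smooth_real (\<lambda>x. f x - g x)"
proof -
  have e: "(deriv ^^ n) (\<lambda>x. f x - g x) = (\<lambda>x. (deriv ^^ n) f x - (deriv ^^ n) g x)" for n
  proof (induction n)
    case (Suc n)
    have "(deriv ^^ n) f field_differentiable (at x)" "(deriv ^^ n) g field_differentiable (at x)" for x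
      using assms by (auto simp: smooth_real_def field_differentiable_def real_differentiable_def)
    thus ?case by (simp add: Suc deriv_diff)
  qed simp
  show ?thesis using assms unfolding smooth_real_def e
    by (auto intro!: derivative_intros)
qed

lemma smooth_real_antideriv:
  assumes "\<And>x. (f has_real_derivative f' x) (at x)" "smooth_real f'"
  shows "smooth_real f"
  unfolding smooth_real_def
proof (intro allI)
  fix n x
  have d: "deriv f = f'" using assms(1) by (auto intro!: DERIV_imp_deriv)
  show "(deriv ^^ n) f differentiable (at x)"
  proof (cases n)
    case 0 thus ?thesis using assms(1) by (auto simp: real_differentiable_def)
  next
    case (Suc n')
    thus ?thesis using assms(2) d by (auto simp: smooth_real_def funpow_Suc_right simp del: funpow.simps)
  qed
qed

text \<open>A smooth function supported in \<open>[a, b]\<close>. As \<open>k\<close> tends to \<open>0\<close> it increases to the indicator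
function of the open interval, so it approximates indicator functions without any convolution.\<close>

definition bump :: "real \<Rightarrow> real \<Rightarrow> real \<Rightarrow> real \<Rightarrow> real" where
  "bump k a b = flat_exp k ([:- a, 1:] * [:b, - 1:]) 0 1"

lemma bump_eq: "a < b \<Longrightarrow> bump k a b x = (if a < x \<and> x < b then exp (- k / ((x - a) * (b - x))) else 0)"
proof -
  assume "a < b"
  hence "0 < (x - a) * (b - x) \<longleftrightarrow> a < x \<and> x < b"
    by (auto simp: zero_less_mult_iff)
  moreover have "poly ([:- a, 1:] * [:b, - 1:]) x = (x - a) * (b - x)"
    by (simp add: algebra_simps)
  ultimately show ?thesis by (simp only: bump_def flat_exp_def) simp
qed

lemma bump_bounds: "k > 0 \<Longrightarrow> a < b \<Longrightarrow> 0 \<le> bump k a b x \<and> bump k a b x \<le> 1"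
  by (auto simp: bump_eq)

lemma bump_translate: "a < b \<Longrightarrow> bump k (a + c) (b + c) x = bump k a b (x - c)"
  by (auto simp: bump_eq algebra_simps)

lemma smooth_bump: "k > 0 \<Longrightarrow> smooth_real (bump k a b)"
  unfolding bump_def by (rule smooth_flat_exp)

lemma continuous_bump: "k > 0 \<Longrightarrow> isCont (bump k a b) x"
  using smooth_bump[of k a b] unfolding smooth_real_def
  by (metis differentiable_imp_continuous_within funpow_0)

text \<open>The difference of two translates of one bump has integral zero, so it has an antiderivative of
compact support, namely \<open>F (x - a) - F (x - c)\<close>, where \<open>F\<close> rises during \<open>[0, d]\<close> and is constant
before and after.
Testing a weak derivative against it compares the averages of the function over the two windows.
Since bumps are at most \<open>1\<close>, the height does not exceed \<open>d\<close>, uniformly in \<open>k\<close>.\<close>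

lemma test_function_with_bump_derivative:
  assumes "k > 0" "d > 0" "a < c"
  obtains \<phi> where "\<phi> \<in> test_functions"
    "\<And>x. deriv \<phi> x = bump k a (a + d) x - bump k c (c + d) x"
    "\<And>x. 0 \<le> \<phi> x \<and> \<phi> x \<le> d" "\<And>x. x \<notin> {a..c + d} \<Longrightarrow> \<phi> x = 0"
    "\<And>x. isCont \<phi> x"
proof -
  obtain F where F: "\<And>x. (F has_real_derivative bump k 0 d x) (at x)"
    using einterval_antiderivative[of "-\<infinity>" \<infinity> "bump k 0 d"] continuous_bump[OF assms(1)]
    unfolding has_real_derivative_iff_has_vector_derivative by force
  have mono: "F x \<le> F y" if "x \<le> y" for x y
    using that by (rule DERIV_nonneg_imp_nondecreasing) (use F bump_bounds assms in blast)
  have const: "F x = F y" if xy: "x < y" and z: "\<And>t. x < t \<Longrightarrow> t < y \<Longrightarrow> bump k 0 d t = 0" for x y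
  proof -
    obtain z where "x < z" "z < y" "F y - F x = (y - x) * bump k 0 d z"
      using MVT2[OF xy, of F] F by blast
    thus ?thesis using z by simp
  qed
  have left: "F x = F 0" if "x \<le> 0" for x
    using that const[of x 0] by (cases "x = 0") (auto simp: bump_eq assms)
  have right: "F x = F d" if "x \<ge> d" for x
    using that const[of d x] by (cases "x = d") (auto simp: bump_eq assms)
  have total: "F d - F 0 \<le> d"
  proof -
    obtain z where "F d - F 0 = (d - 0) * bump k 0 d z"
      using MVT2[of 0 d F] F assms(2) by blast
    thus ?thesis using bump_bounds[OF assms(1,2), of z] assms(2)
      by (simp add: mult_left_le)
  qed
  have lower: "F 0 \<le> F x" for x using left[of x] mono[of 0 x] by linarith
  have upper: "F x \<le> F d" for x using right[of x] mono[of x d] by linarith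
  define \<phi> where "\<phi> = (\<lambda>x. F (x - a) - F (x - c))"
  have d\<phi>: "(\<phi> has_real_derivative bump k a (a + d) x - bump k c (c + d) x) (at x)" for x
  proof -
    have "((\<lambda>x. F (x - s)) has_real_derivative bump k 0 d (x - s)) (at x)" for s
    proof -
      have "((\<lambda>x. x - s) has_real_derivative 1) (at x)" by (auto intro!: derivative_eq_intros)
      from DERIV_chain2[where f = F, OF F this] show ?thesis by simp
    qed
    thus ?thesis using bump_translate[OF assms(2), of k a x] bump_translate[OF assms(2), of k c x]
      unfolding \<phi>_def by (auto intro!: derivative_eq_intros simp: add.commute)
  qed
  have zero: "\<phi> x = 0" if "x \<notin> {a..c + d}" for x
    using that left[of "x - a"] left[of "x - c"] right[of "x - a"] right[of "x - c"] assms
    by (auto simp: \<phi>_def not_le)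
  have bnd: "0 \<le> \<phi> x \<and> \<phi> x \<le> d" for x
    using mono[of "x - c" "x - a"] assms lower[of "x - c"] upper[of "x - a"] total
    by (auto simp: \<phi>_def)
  have "smooth_real \<phi>"
    by (rule smooth_real_antideriv[OF d\<phi>]) (intro smooth_real_diff smooth_bump assms)
  moreover have "compact (closure {x. \<phi> x \<noteq> 0})"
    unfolding compact_closure by (rule bounded_subset[of "{a..c + d}"]) (use zero in \<open>simp, blast\<close>)
  ultimately have "\<phi> \<in> test_functions" by (auto simp: test_functions_def smooth_real_def)
  thus ?thesis
    by (rule that) (use d\<phi> bnd zero DERIV_imp_deriv DERIV_isCont in blast)+
qed

section \<open>Pointwise bounds by the weak derivative on a line\<close>

lemma integral_bump_tendsto:
  fixes f :: "real \<Rightarrow> complex"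
  assumes f: "integrable lebesgue f" and "a < b"
  shows "(\<lambda>n. LINT x|lebesgue. bump (1 / Suc n) a b x *\<^sub>R f x)
           \<longlonglongrightarrow> (LINT x|lebesgue. indicator {a<..<b} x *\<^sub>R f x)"
proof (rule integral_dominated_convergence[where w = "\<lambda>x. norm (f x)"])
  have "bump (1 / Suc n) a b \<in> borel_measurable borel" for n
    by (rule borel_measurable_continuous_onI) (auto intro!: continuous_at_imp_continuous_on continuous_bump)
  hence m: "bump (1 / Suc n) a b \<in> borel_measurable lebesgue" for n
    by (intro measurable_completion) simp
  show "(\<lambda>x. bump (1 / Suc n) a b x *\<^sub>R f x) \<in> borel_measurable lebesgue" for n
    using m f by measurable
  show "AE x in lebesgue. norm (bump (1 / Suc n) a b x *\<^sub>R f x) \<le> norm (f x)" for n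
    using bump_bounds[of "1 / Suc n", OF _ assms(2)] by (auto intro!: mult_left_le_one_le simp: )
  show "AE x in lebesgue. (\<lambda>n. bump (1 / Suc n) a b x *\<^sub>R f x) \<longlonglongrightarrow> indicator {a<..<b} x *\<^sub>R f x"
  proof (intro AE_I2 tendsto_intros)
    fix x
    have "(\<lambda>n. exp (- (1 / Suc n) / ((x - a) * (b - x)))) \<longlonglongrightarrow> exp (- 0 / ((x - a) * (b - x)))"
      if "a < x" "x < b"
      by (intro tendsto_intros LIMSEQ_Suc[OF lim_1_over_n]) (use that in auto)
    thus "(\<lambda>n. bump (1 / Suc n) a b x) \<longlonglongrightarrow> indicator {a<..<b} x"
      by (auto simp: bump_eq[OF assms(2)] indicator_def)
  qed
next
  show "(\<lambda>x. indicator {a<..<b} x *\<^sub>R f x) \<in> borel_measurable lebesgue"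
    using integrable_mult_indicator[OF _ f, of "{a<..<b}"] by (simp add: borel_measurable_integrable)
qed (use f in auto)

text \<open>For the test functions above, the definition of the weak derivative bounds the difference of the
bump averages by the integral of \<open>\<phi> *\<^sub>R g\<close>, where \<open>0 \<le> \<phi> \<le> d\<close>. The bound is independent of
the sharpness of the bumps, so it persists when they turn into indicator functions. Only an
inequality is needed, hence no limit of \<open>\<phi>\<close> has to be computed.\<close>

lemma weak_deriv_window_bound:
  fixes f g :: "real \<Rightarrow> complex"
  assumes w: "has_weak_deriv f g" and f: "integrable lebesgue f" and g: "integrable lebesgue g"
    and "a < c" "0 < d"
  shows "norm ((LINT x|lebesgue. indicator {a<..<a + d} x *\<^sub>R f x)
             - (LINT x|lebesgue. indicator {c<..<c + d} x *\<^sub>R f x))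
         \<le> d * (LINT x|lebesgue. indicator {a..c + d} x * norm (g x))"
proof (rule LIMSEQ_le_const2)
  show "(\<lambda>n. norm ((LINT x|lebesgue. bump (1 / Suc n) a (a + d) x *\<^sub>R f x)
                  - (LINT x|lebesgue. bump (1 / Suc n) c (c + d) x *\<^sub>R f x)))
        \<longlonglongrightarrow> norm ((LINT x|lebesgue. indicator {a<..<a + d} x *\<^sub>R f x)
             - (LINT x|lebesgue. indicator {c<..<c + d} x *\<^sub>R f x))"
    by (intro tendsto_intros integral_bump_tendsto f) (use \<open>0 < d\<close> in auto)
  have "norm ((LINT x|lebesgue. bump (1 / Suc n) a (a + d) x *\<^sub>R f x)
              - (LINT x|lebesgue. bump (1 / Suc n) c (c + d) x *\<^sub>R f x))
        \<le> d * (LINT x|lebesgue. indicator {a..c + d} x * norm (g x))" for n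
  proof -
    obtain \<phi> where \<phi>: "\<phi> \<in> test_functions"
      "\<And>x. deriv \<phi> x = bump (1 / Suc n) a (a + d) x - bump (1 / Suc n) c (c + d) x"
      "\<And>x. 0 \<le> \<phi> x \<and> \<phi> x \<le> d" "\<And>x. x \<notin> {a..c + d} \<Longrightarrow> \<phi> x = 0" "\<And>x. isCont \<phi> x"
      using test_function_with_bump_derivative[of "1 / Suc n" d a c] assms by auto
    have meas: "h \<in> borel_measurable lebesgue" if "\<And>x. isCont h x" for h :: "real \<Rightarrow> real"
      using borel_measurable_continuous_onI[OF continuous_at_imp_continuous_on, of h] that
      by (intro measurable_completion) simp
    have mb: "bump (1 / Suc n) s (s + d) \<in> borel_measurable lebesgue" for s
      by (intro meas continuous_bump) simp
    have int: "integrable lebesgue (\<lambda>x. bump (1 / Suc n) s (s + d) x *\<^sub>R f x)" for s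
      by (rule Bochner_Integration.integrable_bound[OF f])
         (use mb f bump_bounds[of "1 / Suc n" s "s + d"] assms
          in \<open>auto intro!: mult_left_le_one_le\<close>)
    have intr: "integrable lebesgue (\<lambda>x. indicator {a..c + d} x * norm (g x))"
      using integrable_mult_indicator[of "{a..c + d}" lebesgue "\<lambda>x. norm (g x)"] g by simp
    have le: "norm (\<phi> x *\<^sub>R g x) \<le> d * (indicator {a..c + d} x * norm (g x))" for x
      using \<phi>(3,4)[of x] by (auto simp: indicator_def intro!: mult_right_mono)
    have intg: "integrable lebesgue (\<lambda>x. \<phi> x *\<^sub>R g x)"
      by (rule Bochner_Integration.integrable_bound[OF integrable_mult_right[OF intr, of d]])
         (use le meas[OF \<phi>(5)] g assms in \<open>auto simp: abs_mult\<close>)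
    have "(LINT x|lebesgue. bump (1 / Suc n) a (a + d) x *\<^sub>R f x)
              - (LINT x|lebesgue. bump (1 / Suc n) c (c + d) x *\<^sub>R f x)
        = (LINT x|lebesgue. deriv \<phi> x *\<^sub>R f x)"
      unfolding \<phi>(2) scaleR_left_diff_distrib
      by (rule Bochner_Integration.integral_diff[symmetric]) (rule int)+
    also have "\<dots> = - (LINT x|lebesgue. \<phi> x *\<^sub>R g x)"
      using w \<phi>(1) by (simp add: has_weak_deriv_def)
    also have "norm \<dots> \<le> (LINT x|lebesgue. norm (\<phi> x *\<^sub>R g x))"
      unfolding norm_minus_cancel by (rule integral_norm_bound)
    also have "\<dots> \<le> (LINT x|lebesgue. d * (indicator {a..c + d} x * norm (g x)))"
      by (rule integral_mono[OF integrable_norm[OF intg] integrable_mult_right[OF intr] le])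
    finally show ?thesis by simp
  qed
  thus "\<exists>N. \<forall>n\<ge>N. norm ((LINT x|lebesgue. bump (1 / Suc n) a (a + d) x *\<^sub>R f x)
              - (LINT x|lebesgue. bump (1 / Suc n) c (c + d) x *\<^sub>R f x))
        \<le> d * (LINT x|lebesgue. indicator {a..c + d} x * norm (g x))" by blast
qed

lemma interval_avoids_null_set:
  fixes p q :: real
  assumes "N \<in> null_sets lebesgue" "p < q"
  obtains y where "p < y" "y < q" "y \<notin> N"
proof -
  have "\<not> negligible {p<..<q}" using assms(2) by (simp add: open_not_negligible)
  hence "\<not> {p<..<q} \<subseteq> N"
    using assms(1) negligible_iff_null_sets negligible_subset by blast
  then obtain y where "y \<in> {p<..<q}" "y \<notin> N" by blast
  thus ?thesis using that by auto
qed

text \<open>Divide the window bound by the window length and let it tend to zero: at Lebesgue points the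
averages converge to the values. The window at \<open>c\<close> reaches slightly beyond \<open>c\<close>, which is why the
integral extends to some \<open>q > c\<close>. The null set is independent of the points, so the bound can be
used with \<open>a\<close> tending to a given point.\<close>

lemma weak_deriv_increment_bound:
  fixes f g :: "real \<Rightarrow> complex"
  assumes w: "has_weak_deriv f g" and f: "integrable lebesgue f" and g: "integrable lebesgue g"
  obtains N where "N \<in> null_sets lebesgue"
    "\<And>a c q. a \<notin> N \<Longrightarrow> c \<notin> N \<Longrightarrow> a < c \<Longrightarrow> c < q \<Longrightarrow>
       norm (f a - f c) \<le> (LINT x|lebesgue. indicator {a..<q} x * norm (g x))"
proof -
  have int: "f integrable_on cbox a b" for a b :: real
    using w unfolding has_weak_deriv_def locally_integrable_def
    by (meson compact_cbox set_lebesgue_integral_eq_integral(1))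
  obtain N where N: "negligible N" and
    L: "\<And>x e. x \<notin> N \<Longrightarrow> 0 < e \<Longrightarrow> \<exists>d>0. \<forall>h. 0 < h \<and> h < d \<longrightarrow>
          norm (integral (cbox x (x + h *\<^sub>R One)) f /\<^sub>R h ^ DIM(real) - f x) < e"
    using integrable_ccontinuous_explicit[of f] int by blast
  \<comment> \<open>The differentiation theorem concerns gauge integrals over closed intervals, the window bound
    Lebesgue integrals over open ones; the averages are the same.\<close>
  define A where "A h x = (LINT t|lebesgue. indicator {x<..<x + h} t *\<^sub>R f t) /\<^sub>R h" for h x :: real
  have A: "A h x = integral (cbox x (x + h *\<^sub>R One)) f /\<^sub>R h ^ DIM(real)" for h x :: real
  proof -
    have "set_integrable lebesgue {x<..<x + h} f"
      unfolding set_integrable_def by (rule integrable_mult_indicator) (use f in auto)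
    hence "(LINT t|lebesgue. indicator {x<..<x + h} t *\<^sub>R f t) = integral {x<..<x + h} f"
      using set_lebesgue_integral_eq_integral(2) unfolding set_lebesgue_integral_def by blast
    thus ?thesis by (simp add: A_def integral_open_interval_real)
  qed
  show ?thesis
  proof (rule that)
    show "N \<in> null_sets lebesgue" using N by (simp add: negligible_iff_null_sets)
    fix a c q assume a: "a \<notin> N" and c: "c \<notin> N" and ac: "a < c" and cq: "c < (q :: real)"
    define I where "I = (LINT x|lebesgue. indicator {a..<q} x * norm (g x))"
    have intr: "integrable lebesgue (\<lambda>x. indicator S x * norm (g x))" if "S \<in> sets lebesgue" for S
      using integrable_mult_indicator[OF that, of "\<lambda>x. norm (g x)"] g by simp
    have "norm (f a - f c) \<le> I + e" if "e > 0" for e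
    proof -
      obtain d1 where d1: "d1 > 0" "\<And>h. 0 < h \<Longrightarrow> h < d1 \<Longrightarrow> norm (A h a - f a) < e / 2"
        using L[OF a, of "e / 2"] \<open>e > 0\<close> unfolding A by auto
      obtain d2 where d2: "d2 > 0" "\<And>h. 0 < h \<Longrightarrow> h < d2 \<Longrightarrow> norm (A h c - f c) < e / 2"
        using L[OF c, of "e / 2"] \<open>e > 0\<close> unfolding A by auto
      obtain h where "0 < h" "h < min (min d1 d2) (q - c)"
        using dense[of 0 "min (min d1 d2) (q - c)"] d1(1) d2(1) cq by auto
      hence h: "0 < h" "h < d1" "h < d2" "c + h < q" by auto
      have "norm (A h a - A h c)
        = norm ((LINT x|lebesgue. indicator {a<..<a + h} x *\<^sub>R f x)
             - (LINT x|lebesgue. indicator {c<..<c + h} x *\<^sub>R f x)) / h"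
        using h(1) unfolding A_def scaleR_diff_right[symmetric] norm_scaleR
        by (simp add: field_simps)
      also have "\<dots> \<le> (h * (LINT x|lebesgue. indicator {a..c + h} x * norm (g x))) / h"
        by (rule divide_right_mono[OF weak_deriv_window_bound[OF w f g ac h(1)]]) (use h in simp)
      also have "\<dots> = (LINT x|lebesgue. indicator {a..c + h} x * norm (g x))" using h by simp
      also have "\<dots> \<le> I"
        unfolding I_def
        by (intro integral_mono intr mult_right_mono) (use h in \<open>auto simp: indicator_def\<close>)
      finally have "norm (A h a - A h c) \<le> I" .
      moreover have "norm (f a - f c) \<le> norm (A h a - A h c) + norm (A h a - f a) + norm (A h c - f c)"
        by norm
      ultimately show ?thesis using d1(2)[OF h(1,2)] d2(2)[OF h(1,3)] by linarith
    qed
    thus "norm (f a - f c) \<le> I" by (rule field_le_epsilon)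
  qed
qed

lemma integrable_small_value:
  fixes f :: "real \<Rightarrow> complex"
  assumes f: "integrable lebesgue f" and N: "N \<in> null_sets lebesgue" and e: "e > 0"
  obtains c where "c \<notin> N" "norm (f c) < e"
proof (rule ccontr)
  assume "\<not> thesis"
  hence ge: "\<And>c. c \<notin> N \<Longrightarrow> e \<le> norm (f c)" using that not_le by blast
  have "AE c in lebesgue. ennreal e \<le> ennreal (norm (f c))"
    by (rule AE_I'[OF N]) (use ge in \<open>force intro: ennreal_leI\<close>)
  hence "(\<integral>\<^sup>+(c::real). ennreal e \<partial>lebesgue) \<le> (\<integral>\<^sup>+c. ennreal (norm (f c)) \<partial>lebesgue)"
    by (rule nn_integral_mono_AE)
  moreover have "(\<integral>\<^sup>+(c::real). ennreal e \<partial>lebesgue) = \<infinity>"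
    using e by (simp add: ennreal_mult_top)
  moreover have "(\<integral>\<^sup>+c. ennreal (norm (f c)) \<partial>lebesgue) < \<infinity>"
    using f by (simp add: integrable_iff_bounded)
  ultimately show False by simp
qed

text \<open>An integrable function takes arbitrarily small values at good points, so the increment bound
yields the supremum bound. A point of continuity may itself lie in the exceptional null set, but
it is a limit of good points from the right, and both bounds pass to this limit.\<close>

lemma weak_deriv_pointwise_bounds:
  fixes f g :: "real \<Rightarrow> complex"
  assumes w: "has_weak_deriv f g" and f: "integrable lebesgue f" and g: "integrable lebesgue g"
  shows "AE x in lebesgue. norm (f x) \<le> (LINT t|lebesgue. norm (g t))"
    and "isCont f p \<Longrightarrow> norm (f p) \<le> (LINT t|lebesgue. norm (g t))"
    and "isCont f p \<Longrightarrow> AE x in lebesgue. p < x \<and> x < q \<longrightarrow>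
       norm (f x) \<le> norm (f p) + (LINT t|lebesgue. indicator {p..<q} t * norm (g t))"
proof -
  obtain N where N: "N \<in> null_sets lebesgue" and
    inc: "\<And>a c q. a \<notin> N \<Longrightarrow> c \<notin> N \<Longrightarrow> a < c \<Longrightarrow> c < q \<Longrightarrow>
       norm (f a - f c) \<le> (LINT x|lebesgue. indicator {a..<q} x * norm (g x))"
    using weak_deriv_increment_bound[OF w f g] by blast
  define G where "G = (LINT t|lebesgue. norm (g t))"
  have intr: "integrable lebesgue (\<lambda>x. indicator S x * norm (g x))" if "S \<in> sets lebesgue" for S
    using integrable_mult_indicator[OF that, of "\<lambda>x. norm (g x)"] g by simp
  have mono: "(LINT t|lebesgue. indicator {a..<q} t * norm (g t))
      \<le> (LINT t|lebesgue. indicator {p..<q} t * norm (g t))" if "p \<le> a" for p a q :: real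
    by (intro integral_mono intr mult_right_mono) (use that in \<open>auto simp: indicator_def\<close>)
  have leG: "(LINT t|lebesgue. indicator {a..<q} t * norm (g t)) \<le> G" for a q :: real
    unfolding G_def
    by (intro integral_mono intr integrable_norm[OF g]) (auto simp: indicator_def)
  have G0: "G \<ge> 0" by (simp add: G_def)
  have incG: "norm (f a - f c) \<le> G" if "a \<notin> N" "c \<notin> N" for a c
    using inc[of a c "c + 1"] inc[of c a "a + 1"] leG[of a "c + 1"] leG[of c "a + 1"] that G0
    by (cases a c rule: linorder_cases) (auto simp: norm_minus_commute)
  have G: "norm (f x) \<le> G" if "x \<notin> N" for x
  proof (rule field_le_epsilon)
    fix e :: real assume "e > 0"
    then obtain c where c: "c \<notin> N" "norm (f c) < e" using integrable_small_value[OF f N] by blast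
    show "norm (f x) \<le> G + e"
      using norm_triangle_sub[of "f x" "f c"] incG[OF that c(1)] c(2) by linarith
  qed
  have near: "\<exists>y. p < y \<and> y < x \<and> y \<notin> N \<and> norm (f y - f p) < e"
    if ct: "isCont f p" and e: "e > 0" and x: "p < x" for p x e
  proof -
    obtain d where d: "d > 0" "\<And>y. dist y p < d \<Longrightarrow> norm (f y - f p) < e"
      using ct e unfolding continuous_at_eps_delta by (metis dist_norm)
    obtain y where "p < y" "y < min x (p + d)" "y \<notin> N"
      using interval_avoids_null_set[OF N, of p "min x (p + d)"] d x by auto
    thus ?thesis using d(2)[of y] by (auto simp: dist_real_def)
  qed
  show "AE x in lebesgue. norm (f x) \<le> (LINT t|lebesgue. norm (g t))"
    by (rule AE_I'[OF N]) (use G in \<open>auto simp: G_def\<close>)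
  show "norm (f p) \<le> (LINT t|lebesgue. norm (g t))" if "isCont f p"
    unfolding G_def[symmetric]
  proof (rule field_le_epsilon)
    fix e :: real assume "e > 0"
    from near[OF that this, of "p + 1"] obtain y where y: "y \<notin> N" "norm (f y - f p) < e" by auto
    show "norm (f p) \<le> G + e"
      using norm_triangle_sub[of "f p" "f y"] G[OF y(1)] y(2) by (simp add: norm_minus_commute)
  qed
  have "norm (f x) \<le> norm (f p) + (LINT t|lebesgue. indicator {p..<q} t * norm (g t))"
    if ct: "isCont f p" and x: "x \<notin> N" "p < x" "x < q" for x
  proof (rule field_le_epsilon)
    fix e :: real assume "e > 0"
    from near[OF ct this x(2)] obtain y
      where y: "p < y" "y < x" "y \<notin> N" "norm (f y - f p) < e" by auto
    have "norm (f x) \<le> norm (f p) + norm (f y - f x) + norm (f y - f p)"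
      by norm
    thus "norm (f x) \<le> norm (f p) + (LINT t|lebesgue. indicator {p..<q} t * norm (g t)) + e"
      using inc[OF y(3) x(1) y(2) x(3)] mono[of p y q] y by linarith
  qed
  thus "AE x in lebesgue. p < x \<and> x < q \<longrightarrow>
      norm (f x) \<le> norm (f p) + (LINT t|lebesgue. indicator {p..<q} t * norm (g t))"
    if "isCont f p"
    using that by (intro AE_I'[OF N]) blast
qed

section \<open>The discrete Loomis--Whitney inequality\<close>

text \<open>Apply the Cauchy--Schwarz inequality first to the sum over \<open>(j, k)\<close>, with \<open>\<alpha>\<close> as one of the
factors, and then to the inner sum over \<open>i\<close>, whose square is at most the product of a function of
\<open>k\<close> and a function of \<open>j\<close>.\<close>

lemma Loomis_Whitney_sum:
  fixes \<alpha> :: "'j \<Rightarrow> 'k \<Rightarrow> ennreal" and \<beta> :: "'i \<Rightarrow> 'k \<Rightarrow> ennreal" and \<gamma> :: "'i \<Rightarrow> 'j \<Rightarrow> ennreal"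
  shows "(\<integral>\<^sup>+ (j, k). (\<integral>\<^sup>+ i. \<alpha> j k * \<beta> i k * \<gamma> i j \<partial>count_space UNIV) \<partial>count_space UNIV)\<^sup>2
    \<le> (\<integral>\<^sup>+ (j, k). (\<alpha> j k)\<^sup>2 \<partial>count_space UNIV) * (\<integral>\<^sup>+ (i, k). (\<beta> i k)\<^sup>2 \<partial>count_space UNIV)
      * (\<integral>\<^sup>+ (i, j). (\<gamma> i j)\<^sup>2 \<partial>count_space UNIV)"
proof -
  define S where "S j k = (\<integral>\<^sup>+ i. \<beta> i k * \<gamma> i j \<partial>count_space UNIV)" for j k
  define P where "P k = (\<integral>\<^sup>+ i. (\<beta> i k)\<^sup>2 \<partial>count_space UNIV)" for k
  define Q where "Q j = (\<integral>\<^sup>+ i. (\<gamma> i j)\<^sup>2 \<partial>count_space UNIV)" for j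
  have S: "(S j k)\<^sup>2 \<le> P k * Q j" for j k
    unfolding S_def P_def Q_def by (rule Cauchy_Schwarz_nn_integral) auto
  have "(\<integral>\<^sup>+ (j, k). (\<integral>\<^sup>+ i. \<alpha> j k * \<beta> i k * \<gamma> i j \<partial>count_space UNIV) \<partial>count_space UNIV)\<^sup>2
      = (\<integral>\<^sup>+ z. (case z of (j, k) \<Rightarrow> \<alpha> j k) * (case z of (j, k) \<Rightarrow> S j k) \<partial>count_space UNIV)\<^sup>2"
    by (simp add: S_def mult.assoc nn_integral_cmult split_def)
  also have "\<dots> \<le> (\<integral>\<^sup>+ z. (case z of (j, k) \<Rightarrow> \<alpha> j k)\<^sup>2 \<partial>count_space UNIV)
      * (\<integral>\<^sup>+ z. (case z of (j, k) \<Rightarrow> S j k)\<^sup>2 \<partial>count_space UNIV)"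
    by (rule Cauchy_Schwarz_nn_integral) auto
  also have "(\<integral>\<^sup>+ z. (case z of (j, k) \<Rightarrow> S j k)\<^sup>2 \<partial>count_space UNIV)
      \<le> (\<integral>\<^sup>+ z. P (snd z) * Q (fst z) \<partial>count_space UNIV)"
    by (rule nn_integral_mono) (use S in auto)
  also have "\<dots> = (\<integral>\<^sup>+ j. \<integral>\<^sup>+ k. P k * Q j \<partial>count_space UNIV \<partial>count_space UNIV)"
    by (simp add: nn_integral_fst_count_space[symmetric])
  also have "\<dots> = (\<integral>\<^sup>+ k. P k \<partial>count_space UNIV) * (\<integral>\<^sup>+ j. Q j \<partial>count_space UNIV)"
    by (simp add: nn_integral_multc nn_integral_cmult)
  also have "(\<integral>\<^sup>+ k. P k \<partial>count_space UNIV) = (\<integral>\<^sup>+ (i, k). (\<beta> i k)\<^sup>2 \<partial>count_space UNIV)"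
    unfolding P_def using nn_integral_snd_count_space[of "\<lambda>(i, k). (\<beta> i k)\<^sup>2"] by simp
  also have "(\<integral>\<^sup>+ j. Q j \<partial>count_space UNIV) = (\<integral>\<^sup>+ (i, j). (\<gamma> i j)\<^sup>2 \<partial>count_space UNIV)"
    unfolding Q_def using nn_integral_snd_count_space[of "\<lambda>(i, j). (\<gamma> i j)\<^sup>2"] by simp
  finally show ?thesis by (simp add: mult_left_mono split_def mult.assoc)
qed

section \<open>The estimate on all lines of one direction\<close>

lemma nn_integral_eq_sum_over_edges:
  fixes h :: "real \<Rightarrow> ennreal"
  assumes [measurable]: "h \<in> borel_measurable lebesgue" and "l > 0"
  shows "(\<integral>\<^sup>+ x. h x \<partial>lebesgue)
    = (\<integral>\<^sup>+ i. (\<integral>\<^sup>+ x. h x * indicator {of_int i * l..<of_int (i + 1) * l} x \<partial>lebesgue) \<partial>count_space (UNIV :: int set))"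
proof -
  have "(\<integral>\<^sup>+ i. indicator {of_int i * l..<of_int (i + 1) * l} x \<partial>count_space (UNIV :: int set)) = (1 :: ennreal)"
    for x :: real
  proof -
    have "indicator {of_int i * l..<of_int (i + 1) * l} x = (indicator {\<lfloor>x / l\<rfloor>} i :: ennreal)" for i :: int
      using \<open>l > 0\<close> floor_eq_iff[of "x / l" i] by (auto simp: indicator_def field_simps)
    thus ?thesis by simp
  qed
  hence "(\<integral>\<^sup>+ x. h x \<partial>lebesgue) = (\<integral>\<^sup>+ x. (\<integral>\<^sup>+ i. h x * indicator {of_int i * l..<of_int (i + 1) * l} x
      \<partial>count_space (UNIV :: int set)) \<partial>lebesgue)"
    by (simp add: nn_integral_cmult)
  also have "\<dots> = (\<integral>\<^sup>+ i. (\<integral>\<^sup>+ x. h x * indicator {of_int i * l..<of_int (i + 1) * l} x \<partial>lebesgue) \<partial>count_space (UNIV :: int set))"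
    by (rule nn_integral_count_space_nn_integral)
       (auto intro!: borel_measurable_times_ennreal borel_measurable_indicator assms(1))
  finally show ?thesis .
qed

lemma powr_three_halves: "(x :: real) \<ge> 0 \<Longrightarrow> x powr (3/2) = sqrt x * sqrt x * sqrt x"
proof -
  assume "x \<ge> 0"
  have "x powr (3/2) = x powr (1 + 1/2)" by simp
  also have "\<dots> = x * sqrt x" using \<open>x \<ge> 0\<close> unfolding powr_add by (simp add: powr_half_sqrt)
  finally show ?thesis using \<open>x \<ge> 0\<close> by simp
qed

text \<open>Let \<open>f j k\<close> be the restrictions to the lines of one direction, \<open>i\<close> numbering the vertices on each
of them, and let \<open>b i k\<close> and \<open>c i j\<close> be bounds at the vertices, obtained from the lines of the
other two directions. On the edge that starts at vertex \<open>i\<close>, the modulus of \<open>f j k\<close> has three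
bounds: the integral of \<open>norm (g j k)\<close> over the line, and \<open>b i k\<close> or \<open>c i j\<close> increased by the
integral \<open>e i j k\<close> over the edge. Replacing \<open>e i j k\<close> by its sum over \<open>j\<close>, or over \<open>k\<close>, makes
the second and third bounds functions of two indices only, at the cost of one additional \<open>T\<close> in
their sums. The power \<open>3/2\<close> of the modulus is then at most the product of the square roots of the
three bounds, and the Loomis--Whitney inequality applies.\<close>

lemma grid_direction_estimate:
  fixes f g :: "int \<Rightarrow> int \<Rightarrow> real \<Rightarrow> complex" and b c :: "int \<Rightarrow> int \<Rightarrow> real"
  assumes l: "l > 0"
    and w: "\<And>j k. has_weak_deriv (f j k) (g j k)"
    and f: "\<And>j k. integrable lebesgue (f j k)" and g: "\<And>j k. integrable lebesgue (g j k)"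
    and cont: "\<And>i j k. isCont (f j k) (of_int i * l)"
    and vb: "\<And>i j k. norm (f j k (of_int i * l)) \<le> b i k"
    and vc: "\<And>i j k. norm (f j k (of_int i * l)) \<le> c i j"
    and T: "T = (\<integral>\<^sup>+ (j, k). (\<integral>\<^sup>+ x. ennreal (norm (g j k x)) \<partial>lebesgue) \<partial>count_space UNIV)" "T < \<infinity>"
  shows "(\<integral>\<^sup>+ (j, k). (\<integral>\<^sup>+ x. ennreal (norm (f j k x) powr (3/2)) \<partial>lebesgue) \<partial>count_space UNIV)\<^sup>2
    \<le> ennreal (l\<^sup>2) * T * ((\<integral>\<^sup>+ (i, k). ennreal (b i k) \<partial>count_space UNIV) + T)
        * ((\<integral>\<^sup>+ (i, j). ennreal (c i j) \<partial>count_space UNIV) + T)"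
proof -
  define E :: "int \<Rightarrow> real set" where "E i = {of_int i * l..<of_int (i + 1) * l}" for i
  define A where "A j k = (LINT x|lebesgue. norm (g j k x))" for j k
  define e where "e i j k = (LINT x|lebesgue. indicator (E i) x * norm (g j k x))" for i j k
  have [measurable]: "f j k \<in> borel_measurable lebesgue" "g j k \<in> borel_measurable lebesgue" for j k
    by (rule borel_measurable_integrable[OF f], rule borel_measurable_integrable[OF g])
  have b0: "0 \<le> b i k" and c0: "0 \<le> c i j" for i j k
    using order_trans[OF norm_ge_zero vb] order_trans[OF norm_ge_zero vc] by auto
  have A0: "0 \<le> A j k" and e0: "0 \<le> e i j k" for i j k by (auto simp: A_def e_def)
  have A: "ennreal (A j k) = (\<integral>\<^sup>+ x. ennreal (norm (g j k x)) \<partial>lebesgue)" for j k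
    unfolding A_def by (rule nn_integral_eq_integral[symmetric]) (use g in auto)
  have e: "ennreal (e i j k) = (\<integral>\<^sup>+ x. ennreal (norm (g j k x)) * indicator (E i) x \<partial>lebesgue)" for i j k
  proof -
    have "integrable lebesgue (\<lambda>x. indicator (E i) x * norm (g j k x))"
      using integrable_mult_indicator[of "E i" lebesgue "\<lambda>x. norm (g j k x)"] g by (simp add: E_def)
    hence "ennreal (e i j k) = (\<integral>\<^sup>+ x. ennreal (indicator (E i) x * norm (g j k x)) \<partial>lebesgue)"
      unfolding e_def by (intro nn_integral_eq_integral[symmetric]) auto
    thus ?thesis by (simp add: ennreal_mult' ennreal_indicator mult.commute)
  qed
  have sum_e: "(\<integral>\<^sup>+ i. ennreal (e i j k) \<partial>count_space UNIV) = ennreal (A j k)" for j k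
    unfolding A e E_def by (rule nn_integral_eq_sum_over_edges[symmetric]) (use l in auto)
  have TA: "T = (\<integral>\<^sup>+ (j, k). ennreal (A j k) \<partial>count_space UNIV)" by (simp add: T A)

  define SB where "SB i k = (\<integral>\<^sup>+ j. ennreal (e i j k) \<partial>count_space UNIV)" for i k
  define SC where "SC i j = (\<integral>\<^sup>+ k. ennreal (e i j k) \<partial>count_space UNIV)" for i j
  have SB: "(\<integral>\<^sup>+ (i, k). SB i k \<partial>count_space UNIV) = T"
  proof -
    have "(\<integral>\<^sup>+ (i, k). SB i k \<partial>count_space UNIV)
        = (\<integral>\<^sup>+ k. \<integral>\<^sup>+ i. \<integral>\<^sup>+ j. ennreal (e i j k) \<partial>count_space UNIV \<partial>count_space UNIV \<partial>count_space UNIV)"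
      unfolding SB_def
      using nn_integral_snd_count_space[of "\<lambda>(i, k). \<integral>\<^sup>+ j. ennreal (e i j k) \<partial>count_space UNIV"] by simp
    also have "\<dots> = (\<integral>\<^sup>+ k. \<integral>\<^sup>+ j. \<integral>\<^sup>+ i. ennreal (e i j k) \<partial>count_space UNIV \<partial>count_space UNIV \<partial>count_space UNIV)"
      by (subst nn_integral_count_space_nn_integral[of UNIV]) auto
    also have "\<dots> = (\<integral>\<^sup>+ k. \<integral>\<^sup>+ j. ennreal (A j k) \<partial>count_space UNIV \<partial>count_space UNIV)"
      by (simp add: sum_e)
    also have "\<dots> = T"
      unfolding TA using nn_integral_snd_count_space[of "\<lambda>(j, k). ennreal (A j k)"] by simp
    finally show ?thesis .
  qed
  have SC: "(\<integral>\<^sup>+ (i, j). SC i j \<partial>count_space UNIV) = T"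
  proof -
    have "(\<integral>\<^sup>+ (i, j). SC i j \<partial>count_space UNIV)
        = (\<integral>\<^sup>+ j. \<integral>\<^sup>+ i. \<integral>\<^sup>+ k. ennreal (e i j k) \<partial>count_space UNIV \<partial>count_space UNIV \<partial>count_space UNIV)"
      unfolding SC_def
      using nn_integral_snd_count_space[of "\<lambda>(i, j). \<integral>\<^sup>+ k. ennreal (e i j k) \<partial>count_space UNIV"] by simp
    also have "\<dots> = (\<integral>\<^sup>+ j. \<integral>\<^sup>+ k. \<integral>\<^sup>+ i. ennreal (e i j k) \<partial>count_space UNIV \<partial>count_space UNIV \<partial>count_space UNIV)"
      by (subst nn_integral_count_space_nn_integral[of UNIV]) auto
    also have "\<dots> = (\<integral>\<^sup>+ j. \<integral>\<^sup>+ k. ennreal (A j k) \<partial>count_space UNIV \<partial>count_space UNIV)"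
      by (simp add: sum_e)
    also have "\<dots> = T"
      unfolding TA using nn_integral_fst_count_space[of "\<lambda>(j, k). ennreal (A j k)"] by simp
    finally show ?thesis .
  qed
  have SBfin: "SB i k < \<infinity>" for i k
    using nn_integral_ge_point[of "(i, k)" UNIV "\<lambda>(i, k). SB i k"] SB T(2) by auto
  have SCfin: "SC i j < \<infinity>" for i j
    using nn_integral_ge_point[of "(i, j)" UNIV "\<lambda>(i, j). SC i j"] SC T(2) by auto
  have eB: "e i j k \<le> enn2real (SB i k)" for i j k
  proof -
    have "ennreal (e i j k) \<le> SB i k" unfolding SB_def by (rule nn_integral_ge_point) simp
    from enn2real_mono[OF this] show ?thesis using SBfin[of i k] e0[of i j k] by simp
  qed
  have eC: "e i j k \<le> enn2real (SC i j)" for i j k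
  proof -
    have "ennreal (e i j k) \<le> SC i j" unfolding SC_def by (rule nn_integral_ge_point) simp
    from enn2real_mono[OF this] show ?thesis using SCfin[of i j] e0[of i j k] by simp
  qed
  define B where "B i k = b i k + enn2real (SB i k)" for i k
  define C where "C i j = c i j + enn2real (SC i j)" for i j
  have B0: "0 \<le> B i k" and C0: "0 \<le> C i j" for i j k using b0 c0 by (auto simp: B_def C_def)
  have sumB: "(\<integral>\<^sup>+ (i, k). ennreal (B i k) \<partial>count_space UNIV) = (\<integral>\<^sup>+ (i, k). ennreal (b i k) \<partial>count_space UNIV) + T"
  proof -
    have "ennreal (B i k) = ennreal (b i k) + SB i k" for i k
      using b0[of i k] SBfin[of i k] by (simp add: B_def ennreal_plus)
    thus ?thesis unfolding SB[symmetric] by (simp add: nn_integral_add split_def)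
  qed
  have sumC: "(\<integral>\<^sup>+ (i, j). ennreal (C i j) \<partial>count_space UNIV) = (\<integral>\<^sup>+ (i, j). ennreal (c i j) \<partial>count_space UNIV) + T"
  proof -
    have "ennreal (C i j) = ennreal (c i j) + SC i j" for i j
      using c0[of i j] SCfin[of i j] by (simp add: C_def ennreal_plus)
    thus ?thesis unfolding SC[symmetric] by (simp add: nn_integral_add split_def)
  qed

  \<comment> \<open>The edge length \<open>l\<close> is attached to one of the factors, so that a triple product results.\<close>
  have edge: "(\<integral>\<^sup>+ x. ennreal (norm (f j k x) powr (3/2)) * indicator (E i) x \<partial>lebesgue)
      \<le> ennreal (l * sqrt (A j k)) * ennreal (sqrt (B i k)) * ennreal (sqrt (C i j))" for i j k
  proof -
    define K where "K = sqrt (A j k) * sqrt (B i k) * sqrt (C i j)"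
    \<comment> \<open>The interval \<open>E i\<close> contains its left end point, where the pointwise bound is not
      available.\<close>
    have "AE x in lebesgue. x \<noteq> of_int i * l"
      by (rule AE_I'[of "{of_int i * l}"]) (auto simp: negligible_iff_null_sets[symmetric])
    moreover have "AE x in lebesgue. norm (f j k x) \<le> A j k"
      unfolding A_def by (rule weak_deriv_pointwise_bounds(1)[OF w f g])
    moreover have "AE x in lebesgue. of_int i * l < x \<and> x < of_int (i + 1) * l \<longrightarrow>
        norm (f j k x) \<le> norm (f j k (of_int i * l)) + e i j k"
      unfolding e_def E_def by (rule weak_deriv_pointwise_bounds(3)[OF w f g cont])
    ultimately have "AE x in lebesgue. ennreal (norm (f j k x) powr (3/2)) * indicator (E i) x \<le> ennreal K * indicator (E i) x"
    proof eventually_elim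
      case (elim x)
      show ?case
      proof (cases "x \<in> E i")
        case True
        hence "norm (f j k x) \<le> norm (f j k (of_int i * l)) + e i j k"
          using elim by (auto simp: E_def)
        hence "norm (f j k x) \<le> B i k" "norm (f j k x) \<le> C i j"
          using vb[of j k i] vc[of j k i] eB[of i j k] eC[of i j k] unfolding B_def C_def by linarith+
        hence "norm (f j k x) powr (3/2) \<le> K"
          using elim(2) A0 B0 C0 unfolding K_def powr_three_halves[OF norm_ge_zero]
          by (intro mult_mono) auto
        thus ?thesis by (simp add: indicator_def ennreal_leI)
      qed simp
    qed
    hence "(\<integral>\<^sup>+ x. ennreal (norm (f j k x) powr (3/2)) * indicator (E i) x \<partial>lebesgue)
        \<le> (\<integral>\<^sup>+ x. ennreal K * indicator (E i) x \<partial>lebesgue)"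
      by (rule nn_integral_mono_AE)
    also have "\<dots> = ennreal K * ennreal l"
      using l by (subst nn_integral_cmult_indicator) (auto simp: E_def algebra_simps)
    finally show ?thesis
      using l A0 B0 C0 by (simp add: K_def ennreal_mult[symmetric] mult_ac)
  qed
  have "(\<integral>\<^sup>+ x. ennreal (norm (f j k x) powr (3/2)) \<partial>lebesgue)
      \<le> (\<integral>\<^sup>+ i. ennreal (l * sqrt (A j k)) * ennreal (sqrt (B i k)) * ennreal (sqrt (C i j)) \<partial>count_space UNIV)" for j k
    by (subst nn_integral_eq_sum_over_edges[OF _ l]) (use edge[unfolded E_def] in \<open>auto intro!: nn_integral_mono\<close>)
  hence "(\<integral>\<^sup>+ (j, k). (\<integral>\<^sup>+ x. ennreal (norm (f j k x) powr (3/2)) \<partial>lebesgue) \<partial>count_space UNIV)\<^sup>2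
    \<le> (\<integral>\<^sup>+ (j, k). (\<integral>\<^sup>+ i. ennreal (l * sqrt (A j k)) * ennreal (sqrt (B i k)) * ennreal (sqrt (C i j))
          \<partial>count_space UNIV) \<partial>count_space UNIV)\<^sup>2"
    by (auto intro!: power_mono nn_integral_mono)
  also have "\<dots> \<le> (\<integral>\<^sup>+ (j, k). (ennreal (l * sqrt (A j k)))\<^sup>2 \<partial>count_space UNIV)
      * (\<integral>\<^sup>+ (i, k). (ennreal (sqrt (B i k)))\<^sup>2 \<partial>count_space UNIV)
      * (\<integral>\<^sup>+ (i, j). (ennreal (sqrt (C i j)))\<^sup>2 \<partial>count_space UNIV)"
    by (rule Loomis_Whitney_sum)
  also have "\<dots> = ennreal (l\<^sup>2) * T * (\<integral>\<^sup>+ (i, k). ennreal (B i k) \<partial>count_space UNIV)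
      * (\<integral>\<^sup>+ (i, j). ennreal (C i j) \<partial>count_space UNIV)"
    using l A0 B0 C0 unfolding TA
    by (simp add: ennreal_power power_mult_distrib ennreal_mult nn_integral_cmult split_def)
  finally show ?thesis by (simp only: sumB sumC)
qed

section \<open>The inequality on the grid\<close>

lemma locally_integrable_measurable:
  assumes "locally_integrable g"
  shows "g \<in> borel_measurable lebesgue"
proof (rule borel_measurable_LIMSEQ_metric)
  fix n :: nat
  have "g absolutely_integrable_on {- real n..real n}"
    using assms by (auto simp: locally_integrable_def)
  thus "(\<lambda>x. indicator {- real n..real n} x *\<^sub>R g x) \<in> borel_measurable lebesgue"
    unfolding set_integrable_def by (rule borel_measurable_integrable)
next
  fix x :: real
  obtain m :: nat where "\<bar>x\<bar> \<le> real m" using real_arch_simple by blast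
  hence "\<forall>n\<ge>m. indicator {- real n..real n} x *\<^sub>R g x = g x" by (auto simp: indicator_def)
  thus "(\<lambda>n. indicator {- real n..real n} x *\<^sub>R g x) \<longlonglongrightarrow> g x"
    by (intro tendsto_eventually) (auto simp: eventually_sequentially)
qed

lemma isCont_line_point: "isCont (line_point l L) t"
  unfolding isCont_def
proof (rule vec_tendstoI)
  fix i :: 3
  show "((\<lambda>t. line_point l L t $ i) \<longlongrightarrow> line_point l L t $ i) (at t)"
    using exhaust_3[of i] by (cases L) auto
qed

lemma nn_integral_count_space_swap:
  fixes h :: "'a \<Rightarrow> 'b \<Rightarrow> ennreal"
  shows "(\<integral>\<^sup>+ (x, y). h x y \<partial>count_space UNIV) = (\<integral>\<^sup>+ (y, x). h x y \<partial>count_space UNIV)"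
  using nn_integral_fst_count_space[of "\<lambda>(x, y). h x y"]
    nn_integral_snd_count_space[of "\<lambda>(y, x). h x y"] by simp

text \<open>The Cauchy--Schwarz inequality bounds the squares of the sums. The root is extracted only after
the summation, where finiteness of \<open>T\<close> permits the passage to real numbers.\<close>

lemma le_of_square_le_cube:
  fixes I T :: ennreal
  assumes I: "I\<^sup>2 \<le> ennreal (l\<^sup>2) * T * T * T" and "T < \<infinity>" "l > 0"
  shows "I \<le> ennreal (l * enn2real T powr (3/2))"
proof -
  define t where "t = enn2real T"
  have t: "T = ennreal t" "t \<ge> 0" using assms(2) by (auto simp: t_def)
  have I': "I\<^sup>2 \<le> ennreal (l\<^sup>2 * t ^ 3)"
    using I t by (simp add: ennreal_mult[symmetric] power3_eq_cube mult.assoc)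
  hence "I \<noteq> \<infinity>" by (auto simp: ennreal_power top_unique)
  then obtain i where i: "I = ennreal i" "i \<ge> 0" by (cases I) auto
  have "i\<^sup>2 \<le> l\<^sup>2 * t ^ 3" using I' i t by (simp add: ennreal_power)
  also have "\<dots> = (l * t powr (3/2))\<^sup>2"
    using t(2) by (simp add: power_mult_distrib powr_three_halves power3_eq_cube power2_eq_square)
  finally have "i \<le> l * t powr (3/2)" by (rule power2_le_imp_le) (use assms in auto)
  thus ?thesis by (simp add: i t_def ennreal_leI)
qed

theorem proposition3p2:
  fixes l :: real
  assumes "l > 0"
  shows "\<exists>C::real. C > 0 \<and>
    (\<forall>\<psi>\<in>W11_grid l.
       grid_Lp_norm (3/2) (on_lines l \<psi>) \<le> ennreal C * grid_Lp_norm 1 (grid_deriv l \<psi>))"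
proof (intro exI conjI ballI)
  show "(3 * l) powr (2/3) > 0" using assms by simp
next
  fix \<psi> assume \<psi>: "\<psi> \<in> W11_grid l"
  define F where "F = on_lines l \<psi>"
  define G where "G = grid_deriv l \<psi>"
  have W: "F L \<in> W11_real" for L using \<psi> by (auto simp: W11_grid_def F_def)
  hence F: "integrable lebesgue (F L)" for L by (auto simp: W11_real_def)
  \<comment> \<open>The choice in the definition of \<open>G L\<close> yields some weak derivative of \<open>F L\<close>; that it is integrable
    follows below from the finite norm.\<close>
  have wd: "has_weak_deriv (F L) (G L)" for L
  proof -
    have "\<exists>g. has_weak_deriv (F L) g" using W[of L] by (auto simp: W11_real_def)
    thus ?thesis unfolding G_def grid_deriv_def weak_deriv_def F_def by (rule someI_ex)
  qed
  have meas: "G L \<in> borel_measurable lebesgue" for L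
    by (rule locally_integrable_measurable) (use wd in \<open>auto simp: has_weak_deriv_def\<close>)

  define TX where "TX = (\<integral>\<^sup>+ (j, k). (\<integral>\<^sup>+ x. ennreal (norm (G (X j k) x)) \<partial>lebesgue) \<partial>count_space UNIV)"
  define TY where "TY = (\<integral>\<^sup>+ (i, k). (\<integral>\<^sup>+ x. ennreal (norm (G (Y i k) x)) \<partial>lebesgue) \<partial>count_space UNIV)"
  define TZ where "TZ = (\<integral>\<^sup>+ (i, j). (\<integral>\<^sup>+ x. ennreal (norm (G (Z i j) x)) \<partial>lebesgue) \<partial>count_space UNIV)"
  define T where "T = TX + TY + TZ"
  have normG: "grid_Lp_norm 1 G = ennreal_powr T 1"
    by (simp add: grid_Lp_norm_def grid_integral_def T_def TX_def TY_def TZ_def)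
  moreover have "grid_Lp_norm 1 G < \<infinity>"
    using \<psi> by (auto simp: W11_grid_def G_def)
  ultimately have Tfin: "T < \<infinity>" by (auto simp: ennreal_powr_def less_top split: if_splits)
  hence fin: "TX < \<infinity>" "TY < \<infinity>" "TZ < \<infinity>" by (auto simp: T_def)
  have line_fin: "(\<integral>\<^sup>+ x. ennreal (norm (G L x)) \<partial>lebesgue) < \<infinity>" for L
  proof (cases L)
    case (X j k)
    have "(\<integral>\<^sup>+ x. ennreal (norm (G (X j k) x)) \<partial>lebesgue) \<le> TX" unfolding TX_def
      using nn_integral_ge_point[of "(j, k)" UNIV "\<lambda>(j, k). \<integral>\<^sup>+ x. ennreal (norm (G (X j k) x)) \<partial>lebesgue"] by simp
    thus ?thesis using fin X by auto
  next
    case (Y i k)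
    have "(\<integral>\<^sup>+ x. ennreal (norm (G (Y i k) x)) \<partial>lebesgue) \<le> TY" unfolding TY_def
      using nn_integral_ge_point[of "(i, k)" UNIV "\<lambda>(i, k). \<integral>\<^sup>+ x. ennreal (norm (G (Y i k) x)) \<partial>lebesgue"] by simp
    thus ?thesis using fin Y by auto
  next
    case (Z i j)
    have "(\<integral>\<^sup>+ x. ennreal (norm (G (Z i j) x)) \<partial>lebesgue) \<le> TZ" unfolding TZ_def
      using nn_integral_ge_point[of "(i, j)" UNIV "\<lambda>(i, j). \<integral>\<^sup>+ x. ennreal (norm (G (Z i j) x)) \<partial>lebesgue"] by simp
    thus ?thesis using fin Z by auto
  qed
  have G: "integrable lebesgue (G L)" for L
    using line_fin[of L] meas[of L] by (simp add: integrable_iff_bounded)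
  define A where "A L = (LINT x|lebesgue. norm (G L x))" for L
  have A: "ennreal (A L) = (\<integral>\<^sup>+ x. ennreal (norm (G L x)) \<partial>lebesgue)" for L
    unfolding A_def by (rule nn_integral_eq_integral[symmetric]) (use G in auto)

  \<comment> \<open>Restricting continuity on the grid to a single line shows that the value at a vertex is
    controlled by each of the three lines through it.\<close>
  have cont_at_vertex: "isCont (F L) t" if "line_point l L t \<in> grid_vertices l" for L t
  proof -
    have "continuous (at (line_point l L t) within grid l) \<psi>"
      using \<psi> that by (auto simp: W11_grid_def)
    hence "continuous (at (line_point l L t) within range (line_point l L)) \<psi>"
      by (rule continuous_within_subset) (auto simp: grid_def)
    from continuous_within_compose[OF isCont_line_point this]
    moreover have "\<psi> \<circ> line_point l L = F L" by (auto simp: F_def on_lines_def)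
    ultimately show ?thesis by simp
  qed
  have cX: "isCont (F (X j k)) (of_int i * l)" and cY: "isCont (F (Y i k)) (of_int j * l)"
    and cZ: "isCont (F (Z i j)) (of_int k * l)" for i j k
    by (rule cont_at_vertex; auto simp: grid_vertices_def)+
  have bound: "norm (F L t) \<le> A L" if "isCont (F L) t" for L t
    unfolding A_def by (rule weak_deriv_pointwise_bounds(2)[OF wd F G that])
  have vY: "F (Y i k) (of_int j * l) = F (X j k) (of_int i * l)"
    and vZ: "F (Z i j) (of_int k * l) = F (X j k) (of_int i * l)" for i j k
    by (auto simp: F_def on_lines_def)
  have bX: "norm (F (X j k) (of_int i * l)) \<le> A (X j k)"
    and bY: "norm (F (X j k) (of_int i * l)) \<le> A (Y i k)"
    and bZ: "norm (F (X j k) (of_int i * l)) \<le> A (Z i j)" for i j k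
    by (rule bound[OF cX], subst vY[symmetric], rule bound[OF cY],
        subst vZ[symmetric], rule bound[OF cZ])

  have TX: "TX = (\<integral>\<^sup>+ (j, k). ennreal (A (X j k)) \<partial>count_space UNIV)"
    and TY: "TY = (\<integral>\<^sup>+ (i, k). ennreal (A (Y i k)) \<partial>count_space UNIV)"
    and TZ: "TZ = (\<integral>\<^sup>+ (i, j). ennreal (A (Z i j)) \<partial>count_space UNIV)"
    by (simp_all add: TX_def TY_def TZ_def A)
  have product_le_T_cubed: "ennreal (l\<^sup>2) * a * (b + a) * (c + a) \<le> ennreal (l\<^sup>2) * T * T * T"
    if "a \<le> T" "b + a \<le> T" "c + a \<le> T" for a b c
    using that by (intro mult_mono) auto
  define IX where "IX = (\<integral>\<^sup>+ (j, k). (\<integral>\<^sup>+ x. ennreal (norm (F (X j k) x) powr (3/2)) \<partial>lebesgue) \<partial>count_space UNIV)"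
  define IY where "IY = (\<integral>\<^sup>+ (i, k). (\<integral>\<^sup>+ x. ennreal (norm (F (Y i k) x) powr (3/2)) \<partial>lebesgue) \<partial>count_space UNIV)"
  define IZ where "IZ = (\<integral>\<^sup>+ (i, j). (\<integral>\<^sup>+ x. ennreal (norm (F (Z i j) x) powr (3/2)) \<partial>lebesgue) \<partial>count_space UNIV)"
  \<comment> \<open>In each direction \<open>i\<close> in the estimate becomes the coordinate along the line. The swaps below
    account for the order of the indices of \<open>X\<close>, \<open>Y\<close> and \<open>Z\<close>.\<close>
  have "IX\<^sup>2 \<le> ennreal (l\<^sup>2) * TX * (TY + TX) * (TZ + TX)"
    unfolding IX_def TY TZ
    by (rule grid_direction_estimate[OF assms wd F G cX bY bZ TX_def fin(1)])
  also have "\<dots> \<le> ennreal (l\<^sup>2) * T * T * T"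
    by (rule product_le_T_cubed) (auto simp: T_def add_ac)
  finally have IX: "IX \<le> ennreal (l * enn2real T powr (3/2))"
    by (rule le_of_square_le_cube) (use Tfin assms in auto)
  have "IY\<^sup>2 \<le> ennreal (l\<^sup>2) * TY * (TX + TY) * (TZ + TY)"
    unfolding IY_def TX TZ nn_integral_count_space_swap[of "\<lambda>i j. ennreal (A (Z i j))"]
    by (rule grid_direction_estimate[OF assms wd F G cY _ _ TY_def fin(2)]) (unfold vY, rule bX, rule bZ)
  also have "\<dots> \<le> ennreal (l\<^sup>2) * T * T * T"
    by (rule product_le_T_cubed) (auto simp: T_def add_ac)
  finally have IY: "IY \<le> ennreal (l * enn2real T powr (3/2))"
    by (rule le_of_square_le_cube) (use Tfin assms in auto)
  have "IZ\<^sup>2 \<le> ennreal (l\<^sup>2) * TZ * (TX + TZ) * (TY + TZ)"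
    unfolding IZ_def TX TY nn_integral_count_space_swap[of "\<lambda>j k. ennreal (A (X j k))"]
      nn_integral_count_space_swap[of "\<lambda>i k. ennreal (A (Y i k))"]
    by (rule grid_direction_estimate[OF assms wd F G cZ _ _ TZ_def fin(3)]) (unfold vZ, rule bX, rule bY)
  also have "\<dots> \<le> ennreal (l\<^sup>2) * T * T * T"
    by (rule product_le_T_cubed) (auto simp: T_def add_ac)
  finally have IZ: "IZ \<le> ennreal (l * enn2real T powr (3/2))"
    by (rule le_of_square_le_cube) (use Tfin assms in auto)

  define t where "t = enn2real T"
  have I: "IX + IY + IZ \<le> ennreal (3 * l * t powr (3/2))"
  proof -
    have "IX + IY + IZ \<le> ennreal (l * t powr (3/2)) + ennreal (l * t powr (3/2)) + ennreal (l * t powr (3/2))"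
      using IX IY IZ unfolding t_def by (intro add_mono)
    also have "\<dots> = ennreal (3 * l * t powr (3/2))"
      using assms by (simp add: ennreal_plus[symmetric] del: ennreal_plus)
    finally show ?thesis .
  qed
  have Ifin: "IX + IY + IZ \<noteq> \<infinity>" using I by (auto simp: top_unique)
  have "enn2real (IX + IY + IZ) \<le> 3 * l * t powr (3/2)"
    using enn2real_mono[OF I] assms by simp
  hence "enn2real (IX + IY + IZ) powr (2/3) \<le> (3 * l * t powr (3/2)) powr (2/3)"
    by (intro powr_mono2) auto
  also have "\<dots> = (3 * l) powr (2/3) * t"
    using assms by (simp add: powr_mult powr_powr t_def)
  finally have main: "enn2real (IX + IY + IZ) powr (2/3) \<le> (3 * l) powr (2/3) * t" .
  have "grid_Lp_norm (3/2) F = ennreal (enn2real (IX + IY + IZ) powr (2/3))"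
    using Ifin by (simp add: grid_Lp_norm_def grid_integral_def IX_def IY_def IZ_def ennreal_powr_def)
  also have "\<dots> \<le> ennreal ((3 * l) powr (2/3) * t)" using main by (rule ennreal_leI)
  also have "\<dots> = ennreal ((3 * l) powr (2/3)) * grid_Lp_norm 1 G"
    using Tfin by (simp add: normG ennreal_powr_def t_def ennreal_mult)
  finally show "grid_Lp_norm (3/2) (on_lines l \<psi>)
      \<le> ennreal ((3 * l) powr (2/3)) * grid_Lp_norm 1 (grid_deriv l \<psi>)"
    by (simp add: F_def G_def)
qed

end
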